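(* Let $u,b,k\ge 1$ and $w\ge 0$ be integers with $bk=2u+w$ and $2u>b$. Then every connected full design $d_0$ with parameters $(u,b,k)$ satisfies $A(d_0)\ge A_{\mathrm{bound}}$, where $\sigma^2A(d_0)$ is the sum of the variances of the best linear unbiased estimators of all pairwise treatment contrasts in $d_0$ and $$A_{\mathrm{bound}}=\tfrac12 w(3u+2w-b-1)+u\,\frac{(u-1)^2}{2u-b}+kw\,\frac{(b-1)^2}{u}.$$
   Context: A full design $d_0$ with parameters $(u,b,k)$ is a block design with $b$ blocks, each consisting of $k$ plots, each plot receiving one treatment, with $v=u+w$ treatments ($w=bk-2u$): a set $U$ of $u$ treatments, each occurring on exactly two plots, and a set $W$ of $w$ treatments, each occurring on exactly one plot. A treatment may occur twice in the same block (binarity is not assumed). Model: the observation from a plot in block $j$ receiving treatment $t$ has expectation (fixed effect of $t$) + (fixed effect of block $j$); observations are uncorrelated with common variance $\sigma^2$. $d_0$ is connected if every difference of two treatment effects is estimable. The pairwise treatment contrasts are the $v(v-1)/2$ differences of effects of two distinct treatments. Equivalently, $$A(d_0)=\tfrac12 w(3u+2w-b-1)+u\,\mathrm{tr}(C^+)+\tfrac12 k\{w\,\mathrm{tr}(\tilde C^+)+b\,\mathrm{tr}(\tilde C^+S)\},$$ where $s_j$ is the number of plots of block $j$ occupied by treatments in $W$ (connectedness forces $0\le s_j\le k-1$), $S=\mathrm{diag}(s_1,\dots,s_b)$, $N=(n_{ij})$ is the $u\times b$ matrix with $n_{ij}$ the number of times treatment $i\in U$ occurs in block $j$, $C=2I_u-N(kI_b-S)^{-1}N^T$,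 $\tilde C=kI_b-S-\tfrac12N^TN$, and $^+$ denotes the Moore–Penrose inverse. *)

theory Defs
  imports "HOL-Probability.Probability"
begin

(* A design is given by its plots (all of type 'p), blocks (all of type 'j) and treatments
   (all of type 't): blk p is the block containing plot p and trt p the treatment it receives.
   U is the set of twice-replicated treatments and W is its complement. Nothing prevents a
   treatment in U from occurring twice in one block. *)

definition full_design ::
  "nat \<Rightarrow> nat \<Rightarrow> nat \<Rightarrow> ('p::finite \<Rightarrow> 'j::finite) \<Rightarrow> ('p \<Rightarrow> 't::finite) \<Rightarrow> 't set \<Rightarrow> bool"
  where "full_design u b k blk trt U \<longleftrightarrow>
    CARD('j) = b \<and> (\<forall>j. card {p. blk p = j} = k) \<and>
    card U = u \<and> card (- U) + 2 * u = b * k \<and>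
    (\<forall>i\<in>U. card {p. trt p = i} = 2) \<and>
    (\<forall>i\<in>- U. card {p. trt p = i} = 1)"

definition covariance :: "'o measure \<Rightarrow> ('o \<Rightarrow> real) \<Rightarrow> ('o \<Rightarrow> real) \<Rightarrow> real"
  where "covariance M X Z =
    prob_space.expectation M
      (\<lambda>\<omega>. (X \<omega> - prob_space.expectation M X) * (Z \<omega> - prob_space.expectation M Z))"

(* M \<tau> \<beta> is the law when the treatment effects are \<tau> and the block effects are \<beta>;
   Y p is the observation from plot p. No distributional assumption is made beyond
   first and second moments, so the law may depend on (\<tau>, \<beta>) otherwise arbitrarily. *)

definition block_model ::
  "('p::finite \<Rightarrow> 'j::finite) \<Rightarrow> ('p \<Rightarrow> 't::finite) \<Rightarrow> real \<Rightarrow>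
    (('t \<Rightarrow> real) \<Rightarrow> ('j \<Rightarrow> real) \<Rightarrow> 'o measure) \<Rightarrow> ('p \<Rightarrow> 'o \<Rightarrow> real) \<Rightarrow> bool"
  where "block_model blk trt \<sigma> M Y \<longleftrightarrow>
    (\<forall>\<tau> \<beta>. prob_space (M \<tau> \<beta>) \<and>
      (\<forall>p. integrable (M \<tau> \<beta>) (Y p) \<and> integrable (M \<tau> \<beta>) (\<lambda>\<omega>. (Y p \<omega>)\<^sup>2) \<and>
        prob_space.expectation (M \<tau> \<beta>) (Y p) = \<tau> (trt p) + \<beta> (blk p)) \<and>
      (\<forall>p q. covariance (M \<tau> \<beta>) (Y p) (Y q) = (if p = q then \<sigma>\<^sup>2 else 0)))"

definition linear_estimator :: "('p::finite \<Rightarrow> 'o \<Rightarrow> real) \<Rightarrow> ('p \<Rightarrow> real) \<Rightarrow> 'o \<Rightarrow> real"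
  where "linear_estimator Y c = (\<lambda>\<omega>. \<Sum>p\<in>UNIV. c p * Y p \<omega>)"

definition unbiased ::
  "(('t \<Rightarrow> real) \<Rightarrow> ('j \<Rightarrow> real) \<Rightarrow> 'o measure) \<Rightarrow> ('p::finite \<Rightarrow> 'o \<Rightarrow> real) \<Rightarrow>
    (('t \<Rightarrow> real) \<Rightarrow> ('j \<Rightarrow> real) \<Rightarrow> real) \<Rightarrow> ('p \<Rightarrow> real) \<Rightarrow> bool"
  where "unbiased M Y f c \<longleftrightarrow>
    (\<forall>\<tau> \<beta>. prob_space.expectation (M \<tau> \<beta>) (linear_estimator Y c) = f \<tau> \<beta>)"

definition estimable ::
  "(('t \<Rightarrow> real) \<Rightarrow> ('j \<Rightarrow> real) \<Rightarrow> 'o measure) \<Rightarrow> ('p::finite \<Rightarrow> 'o \<Rightarrow> real) \<Rightarrow>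
    (('t \<Rightarrow> real) \<Rightarrow> ('j \<Rightarrow> real) \<Rightarrow> real) \<Rightarrow> bool"
  where "estimable M Y f \<longleftrightarrow> (\<exists>c. unbiased M Y f c)"

definition is_BLUE ::
  "(('t \<Rightarrow> real) \<Rightarrow> ('j \<Rightarrow> real) \<Rightarrow> 'o measure) \<Rightarrow> ('p::finite \<Rightarrow> 'o \<Rightarrow> real) \<Rightarrow>
    (('t \<Rightarrow> real) \<Rightarrow> ('j \<Rightarrow> real) \<Rightarrow> real) \<Rightarrow> ('p \<Rightarrow> real) \<Rightarrow> bool"
  where "is_BLUE M Y f c \<longleftrightarrow> unbiased M Y f c \<and>
    (\<forall>c'. unbiased M Y f c' \<longrightarrow>
      (\<forall>\<tau> \<beta>. prob_space.variance (M \<tau> \<beta>) (linear_estimator Y c)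
            \<le> prob_space.variance (M \<tau> \<beta>) (linear_estimator Y c')))"

definition BLUE ::
  "(('t \<Rightarrow> real) \<Rightarrow> ('j \<Rightarrow> real) \<Rightarrow> 'o measure) \<Rightarrow> ('p::finite \<Rightarrow> 'o \<Rightarrow> real) \<Rightarrow>
    (('t \<Rightarrow> real) \<Rightarrow> ('j \<Rightarrow> real) \<Rightarrow> real) \<Rightarrow> 'o \<Rightarrow> real"
  where "BLUE M Y f = linear_estimator Y (SOME c. is_BLUE M Y f c)"

definition contrast :: "'t \<Rightarrow> 't \<Rightarrow> ('t \<Rightarrow> real) \<Rightarrow> ('j \<Rightarrow> real) \<Rightarrow> real"
  where "contrast s t = (\<lambda>\<tau> \<beta>. \<tau> s - \<tau> t)"

definition connected_design ::
  "(('t \<Rightarrow> real) \<Rightarrow> ('j \<Rightarrow> real) \<Rightarrow> 'o measure) \<Rightarrow> ('p::finite \<Rightarrow> 'o \<Rightarrow> real) \<Rightarrow> bool"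
  where "connected_design M Y \<longleftrightarrow> (\<forall>s t. estimable M Y (contrast s t))"

(* The factor 1/2 compensates for each unordered pair of treatments {s, t} being listed
   both as (s, t) and as (t, s). *)

definition A_value ::
  "real \<Rightarrow> (('t::finite \<Rightarrow> real) \<Rightarrow> ('j \<Rightarrow> real) \<Rightarrow> 'o measure) \<Rightarrow> ('p::finite \<Rightarrow> 'o \<Rightarrow> real) \<Rightarrow>
    ('t \<Rightarrow> real) \<Rightarrow> ('j \<Rightarrow> real) \<Rightarrow> real"
  where "A_value \<sigma> M Y \<tau> \<beta> =
    (1/2 * (\<Sum>(s, t) | s \<noteq> t. prob_space.variance (M \<tau> \<beta>) (BLUE M Y (contrast s t)))) / \<sigma>\<^sup>2"

definition A_bound :: "nat \<Rightarrow> nat \<Rightarrow> nat \<Rightarrow> nat \<Rightarrow> real"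
  where "A_bound u b k w =
    1/2 * real w * (3 * real u + 2 * real w - real b - 1)
    + real u * ((real u - 1)\<^sup>2 / (2 * real u - real b))
    + real k * real w * ((real b - 1)\<^sup>2 / real u)"

end

(* An unbiased linear estimator c of the contrast of s and t satisfies, for every choice of
   effects, |c|^2 >= 2 (tau s - tau t) - |X(tau, beta)|^2, where X(tau, beta) is the vector of
   plot expectations, so every choice of effects yields a lower bound on the variance.

   If s and t are both twice replicated, a multiple of the contrast itself, the same for all
   pairs, with block effects fitted to it, leads to the first quotient of the bound.

   For the other pairs the test effects are the exact solution of the normal equations, built
   from a generalized inverse G of the block information matrix C. Summing over all these pairs
   leaves constants plus (b k / 2) sum_j s_j G_jj + (w k / 2) tr G. Testing G against multiples
   of unit vectors gives G_jj >= 2 g (1 - 1/b) - g^2 d_j / 2, with d_j = k - s_j; the single value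
   g = (b - 1) / u suffices for both sums, because sum_j d_j = 2 u and, by Cauchy-Schwarz,
   sum_j d_j^2 >= 4 u^2 / b. *)

theory Submission
  imports Defs
begin

section \<open>Generalized inverse of a symmetric matrix with zero row sums\<close>

text \<open>The three properties of \<open>G\<close> make it the Moore-Penrose inverse of
  \<open>C\<close>: the product \<open>C G\<close> is the projection onto the vectors of sum
  zero.\<close>

lemma laplacian_pseudoinverse:
  fixes C :: "'j::finite \<Rightarrow> 'j \<Rightarrow> real"
  assumes sym: "\<And>i j. C i j = C j i"
    and row: "\<And>i. (\<Sum>j\<in>UNIV. C i j) = 0"
    and ker: "\<And>x. (\<And>i. (\<Sum>j\<in>UNIV. C i j * x j) = 0) \<Longrightarrow> (\<Sum>j\<in>UNIV. x j) = 0 \<Longrightarrow> x = (\<lambda>_. 0)"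
  obtains G where "\<And>i j. G i j = G j i" "\<And>i. (\<Sum>j\<in>UNIV. G i j) = 0"
    "\<And>i j. (\<Sum>l\<in>UNIV. C i l * G l j) = of_bool (i = j) - 1 / real CARD('j)"
proof -
  define b where "b = real CARD('j)"
  have b: "b > 0" unfolding b_def by simp
  \<comment> \<open>Adding the all-ones matrix removes the kernel of \<open>C\<close>.\<close>
  define A :: "real^'j^'j" where "A = (\<chi> i j. C i j + 1)"
  have col: "(\<Sum>i\<in>UNIV. C i j) = 0" for j
    using row[of j] by (simp add: sym)
  have "x = 0" if x: "A *v x = 0" for x
  proof -
    have e: "(\<Sum>j\<in>UNIV. C i j * x $ j) + (\<Sum>j\<in>UNIV. x $ j) = 0" for i
      using arg_cong[OF x, of "\<lambda>z. z $ i"]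
      by (simp add: A_def matrix_vector_mult_def algebra_simps sum.distrib)
    \<comment> \<open>Adding up all rows of \<open>A *v x = 0\<close> removes the part from
      \<open>C\<close>, whose column sums vanish. So \<open>x\<close> has sum zero and
      \<open>ker\<close> applies.\<close>
    have "(\<Sum>i\<in>UNIV. \<Sum>j\<in>UNIV. C i j * x $ j) = (\<Sum>j\<in>UNIV. (\<Sum>i\<in>UNIV. C i j) * x $ j)"
      unfolding sum_distrib_right by (rule sum.swap)
    hence "(\<Sum>i\<in>(UNIV::'j set). (\<Sum>j\<in>UNIV. C i j * x $ j) + (\<Sum>j\<in>UNIV. x $ j)) = b * (\<Sum>j\<in>UNIV. x $ j)"
      by (simp add: sum.distrib col b_def)
    hence s: "(\<Sum>j\<in>UNIV. x $ j) = 0" using e b by simp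
    have "(\<lambda>j. x $ j) = (\<lambda>_. 0)"
      by (rule ker) (use e s in auto)
    thus ?thesis by (simp add: vec_eq_iff fun_eq_iff)
  qed
  hence "invertible A"
    unfolding invertible_left_inverse matrix_left_invertible_ker by blast
  then obtain B where AB: "A ** B = mat 1" and BA: "B ** A = mat 1"
    unfolding invertible_def by blast
  have tA: "transpose A = A"
    by (simp add: vec_eq_iff transpose_def A_def sym)
  have "transpose B ** A = mat 1"
    using arg_cong[OF AB, of transpose] by (simp add: matrix_transpose_mul tA transpose_mat)
  hence "transpose B = B"
    by (metis AB matrix_mul_assoc matrix_mul_lid matrix_mul_rid)
  hence Bs: "B $ i $ j = B $ j $ i" for i j
    by (metis transpose_def vec_lambda_beta)
  have "A *v (\<chi> i. 1) = b *\<^sub>R (\<chi> i. 1)"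
    by (simp add: vec_eq_iff matrix_vector_mult_def A_def sum.distrib row b_def)
  hence "(\<chi> i. 1) = b *\<^sub>R (B *v (\<chi> i. 1))"
    by (metis BA matrix_vector_mul_assoc matrix_vector_mul_lid matrix_vector_mult_scaleR)
  hence Brow: "(\<Sum>j\<in>UNIV. B $ i $ j) = 1 / b" for i
    using b by (simp add: vec_eq_iff matrix_vector_mult_def field_simps)
  have Bcol: "(\<Sum>j\<in>UNIV. B $ j $ i) = 1 / b" for i
    using Brow[of i] by (simp add: Bs)
  have AB': "(\<Sum>l\<in>UNIV. (C i l + 1) * B $ l $ j) = of_bool (i = j)" for i j
    using arg_cong[OF AB, of "\<lambda>z. z $ i $ j"]
    by (simp add: matrix_matrix_mult_def A_def mat_def)
  show thesis
  \<comment> \<open>The all-ones vector is an eigenvector of \<open>A\<close> with eigenvalue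
    \<open>b\<close>, so \<open>B\<close> has row sums \<open>1 / b\<close>. Spreading this over
    \<open>b\<close> entries gives the correction \<open>1 / b\<^sup>2\<close>, and \<open>C\<close>
    annihilates it.\<close>
  proof (rule that[of "\<lambda>i j. B $ i $ j - 1 / b\<^sup>2"])
    fix i j
    show "B $ i $ j - 1 / b\<^sup>2 = B $ j $ i - 1 / b\<^sup>2" by (simp add: Bs)
    show "(\<Sum>j\<in>UNIV. B $ i $ j - 1 / b\<^sup>2) = 0"
      using b by (simp add: sum_subtractf Brow b_def power2_eq_square)
    have "(\<Sum>l\<in>UNIV. C i l * (B $ l $ j - 1 / b\<^sup>2))
        = (\<Sum>l\<in>UNIV. (C i l + 1) * B $ l $ j) - (\<Sum>l\<in>UNIV. B $ l $ j) - (\<Sum>l\<in>UNIV. C i l) / b\<^sup>2"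
      unfolding sum_divide_distrib sum_subtractf[symmetric]
      by (rule sum.cong) (simp_all add: field_simps)
    thus "(\<Sum>l\<in>UNIV. C i l * (B $ l $ j - 1 / b\<^sup>2)) = of_bool (i = j) - 1 / real CARD('j)"
      by (simp add: AB' Bcol row b_def)
  qed
qed

section \<open>Incidence numbers and the block information matrix\<close>

text \<open>Connectedness is stated without estimators: effects under which every plot has
  expectation zero cannot distinguish two treatments. Estimability of all contrasts implies
  this.\<close>

locale incidence =
  fixes n :: "'t::finite \<Rightarrow> 'j::finite \<Rightarrow> nat" and U :: "'t set" and k :: nat
  assumes block_size: "\<And>j. (\<Sum>t\<in>UNIV. n t j) = k"
    and replication: "\<And>t. (\<Sum>j\<in>UNIV. n t j) = (if t \<in> U then 2 else 1)"
    and k_pos: "k > 0"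
    and U_nonempty: "U \<noteq> {}"
    and connected: "\<And>\<tau> \<beta> s t. (\<And>t j. n t j > 0 \<Longrightarrow> \<tau> t + \<beta> j = (0::real)) \<Longrightarrow> \<tau> s = \<tau> t"
begin

definition r :: "'t \<Rightarrow> real" where "r t = (if t \<in> U then 2 else 1)"

definition y :: "'t \<Rightarrow> 'j \<Rightarrow> real" where "y t j = real (n t j) / r t"

text \<open>The sum runs over all treatments: singly replicated ones contribute \<open>S\<close>, so \<open>C\<close> is the
  matrix \<open>k I - S - N\<^sup>T N / 2\<close> of the context.\<close>

definition C :: "'j \<Rightarrow> 'j \<Rightarrow> real"
  where "C j l = (if j = l then real k else 0) - (\<Sum>t\<in>UNIV. r t * y t j * y t l)"

text \<open>By \<open>model_norm\<close>, this is the least squared norm of the plot expectations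
  that any choice of treatment effects allows for given block effects.\<close>

definition q :: "('j \<Rightarrow> real) \<Rightarrow> real"
  where "q \<beta> = (\<Sum>j\<in>UNIV. \<Sum>l\<in>UNIV. C j l * \<beta> j * \<beta> l)"

definition d :: "'j \<Rightarrow> real" where "d j = (\<Sum>t\<in>U. real (n t j))"

text \<open>The mean block effect over the plots of \<open>t\<close>. Its negative is the treatment
  effect that best cancels the block effects.\<close>

definition m :: "('j \<Rightarrow> real) \<Rightarrow> 't \<Rightarrow> real" where "m \<beta> t = (\<Sum>j\<in>UNIV. y t j * \<beta> j)"

lemma r_pos: "r t > 0" by (simp add: r_def)

lemma n_eq: "real (n t j) = r t * y t j" using r_pos[of t] by (simp add: y_def)

lemma sum_n: "(\<Sum>j\<in>UNIV. real (n t j)) = r t"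
  using replication[of t] by (simp add: r_def flip: of_nat_sum)

lemma sum_y: "(\<Sum>j\<in>UNIV. y t j) = 1"
  using sum_n[of t] r_pos[of t] by (simp add: y_def flip: sum_divide_distrib)

lemma sum_n_block: "(\<Sum>t\<in>UNIV. real (n t j)) = real k"
  using block_size[of j] by (simp flip: of_nat_sum)

lemma n_nonU: "t \<notin> U \<Longrightarrow> \<exists>j0. \<forall>j. n t j = of_bool (j = j0)"
  using replication[of t] by (auto simp: sum_eq_Suc0_iff)

lemma C_sym: "C j l = C l j"
  by (auto simp: C_def mult_ac)

lemma C_row: "(\<Sum>l\<in>UNIV. C j l) = 0"
proof -
  have "(\<Sum>l\<in>UNIV. \<Sum>t\<in>UNIV. r t * y t j * y t l) = (\<Sum>t\<in>UNIV. r t * y t j * (\<Sum>l\<in>UNIV. y t l))"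
    unfolding sum_distrib_left by (rule sum.swap)
  also have "\<dots> = k" using sum_n_block[of j] by (simp add: sum_y n_eq)
  finally show ?thesis by (simp add: C_def sum_subtractf)
qed

lemma q_eq: "q \<beta> = real k * (\<Sum>j\<in>UNIV. (\<beta> j)\<^sup>2) - (\<Sum>t\<in>UNIV. r t * (m \<beta> t)\<^sup>2)"
proof -
  have "r t * (m \<beta> t)\<^sup>2 = (\<Sum>j\<in>UNIV. \<Sum>l\<in>UNIV. r t * y t j * y t l * \<beta> j * \<beta> l)" for t
    unfolding m_def power2_eq_square sum_product unfolding sum_distrib_left
    by (intro sum.cong) (simp_all add: mult_ac)
  hence "(\<Sum>t\<in>UNIV. r t * (m \<beta> t)\<^sup>2) = (\<Sum>j\<in>UNIV. \<Sum>t\<in>UNIV. \<Sum>l\<in>UNIV. r t * y t j * y t l * \<beta> j * \<beta> l)"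
    by (simp add: sum.swap[of _ "UNIV::'j set" "UNIV::'t set"])
  also have "\<dots> = (\<Sum>j\<in>UNIV. \<Sum>l\<in>UNIV. \<Sum>t\<in>UNIV. r t * y t j * y t l * \<beta> j * \<beta> l)"
    by (intro sum.cong refl sum.swap)
  finally have 1: "(\<Sum>t\<in>UNIV. r t * (m \<beta> t)\<^sup>2) = \<dots>" .
  have 2: "real k * (\<Sum>j\<in>UNIV. (\<beta> j)\<^sup>2) = (\<Sum>j\<in>UNIV. \<Sum>l\<in>UNIV. (if j = l then real k else 0) * \<beta> j * \<beta> l)"
    by (simp add: sum_distrib_left if_distrib if_distribR power2_eq_square mult_ac cong: if_cong)
  show ?thesis
    unfolding 1 2 q_def C_def
    by (simp add: sum_subtractf left_diff_distrib sum_distrib_right)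
qed

text \<open>Over the plots of one treatment the deviations of the block effects from their mean
  \<open>m \<beta> t\<close> sum to zero, so the cross term with \<open>a t\<close> vanishes and the
  squared norm splits.\<close>

lemma model_norm:
  "(\<Sum>t\<in>UNIV. \<Sum>j\<in>UNIV. real (n t j) * (a t - m \<beta> t + \<beta> j)\<^sup>2) = (\<Sum>t\<in>UNIV. r t * (a t)\<^sup>2) + q \<beta>"
proof -
  have 1: "(\<Sum>j\<in>UNIV. real (n t j) * (a t - m \<beta> t + \<beta> j)\<^sup>2)
      = r t * (a t)\<^sup>2 - r t * (m \<beta> t)\<^sup>2 + (\<Sum>j\<in>UNIV. real (n t j) * (\<beta> j)\<^sup>2)" for t
  proof -
    let ?c = "a t - m \<beta> t"
    have "(\<Sum>j\<in>UNIV. real (n t j) * (?c + \<beta> j)\<^sup>2)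
       = (\<Sum>j\<in>UNIV. ?c\<^sup>2 * real (n t j) + 2 * ?c * r t * (y t j * \<beta> j) + real (n t j) * (\<beta> j)\<^sup>2)"
      by (rule sum.cong) (simp_all add: n_eq power2_eq_square algebra_simps)
    also have "\<dots> = ?c\<^sup>2 * r t + 2 * ?c * r t * m \<beta> t + (\<Sum>j\<in>UNIV. real (n t j) * (\<beta> j)\<^sup>2)"
      unfolding sum.distrib sum_distrib_left[symmetric] sum_n m_def ..
    finally show ?thesis by (simp add: power2_eq_square algebra_simps)
  qed
  have "(\<Sum>t\<in>UNIV. \<Sum>j\<in>UNIV. real (n t j) * (\<beta> j)\<^sup>2) = (\<Sum>j\<in>UNIV. (\<Sum>t\<in>UNIV. real (n t j)) * (\<beta> j)\<^sup>2)"
    unfolding sum_distrib_right by (rule sum.swap)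
  thus ?thesis
    unfolding 1 by (simp add: sum.distrib sum_subtractf q_eq sum_n_block sum_distrib_left)
qed

text \<open>A kernel vector has \<open>q \<beta> = 0\<close>, so with treatment effects
  \<open>- m \<beta> t\<close> all plot expectations vanish. Connectedness makes
  \<open>m \<beta>\<close> constant; as no block is empty, the block effects equal that constant,
  and sum zero forces it to be 0.\<close>

lemma C_kernel:
  assumes C0: "\<And>i. (\<Sum>j\<in>UNIV. C i j * \<beta> j) = 0" and s: "(\<Sum>j\<in>UNIV. \<beta> j) = 0"
  shows "\<beta> = (\<lambda>_. 0)"
proof -
  have "q \<beta> = (\<Sum>i\<in>UNIV. \<beta> i * (\<Sum>j\<in>UNIV. C i j * \<beta> j))"
    unfolding q_def sum_distrib_left by (intro sum.cong) (simp_all add: mult_ac)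
  hence "(\<Sum>t\<in>UNIV. \<Sum>j\<in>UNIV. real (n t j) * (0 - m \<beta> t + \<beta> j)\<^sup>2) = 0"
    unfolding model_norm by (simp add: C0)
  hence "\<forall>t j. real (n t j) * (0 - m \<beta> t + \<beta> j)\<^sup>2 = 0"
    by (simp add: sum_nonneg_eq_0_iff sum_nonneg)
  hence 1: "- m \<beta> t + \<beta> j = 0" if "n t j > 0" for t j using that by (force simp: algebra_simps)
  have "- m \<beta> s = - m \<beta> t" for s t
    by (rule connected[of "\<lambda>t. - m \<beta> t" \<beta>]) (rule 1)
  hence mc: "m \<beta> s = m \<beta> t" for s t by simp
  obtain t0 :: 't where True by simp
  have b0: "\<beta> j = m \<beta> t0" for j
  proof -
    obtain t where "n t j > 0"
      using block_size[of j] k_pos by (metis gr0I sum.neutral)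
    thus ?thesis using 1[of t j] mc[of t t0] by simp
  qed
  hence "(\<Sum>j\<in>UNIV. \<beta> j) = real CARD('j) * m \<beta> t0" by simp
  thus ?thesis using s b0 by (simp add: fun_eq_iff)
qed

text \<open>If block \<open>j\<close> had only singly replicated treatments, its block effect could be absorbed
  into theirs.\<close>

lemma d_pos: "d j \<ge> 1"
proof (rule ccontr)
  assume "\<not> ?thesis"
  hence "(\<Sum>t\<in>U. n t j) = 0" unfolding d_def of_nat_sum[symmetric] by linarith
  hence U0: "n t j = 0" if "t \<in> U" for t using that by simp
  obtain t where t: "n t j > 0"
    using block_size[of j] k_pos by (metis gr0I sum.neutral)
  obtain i where i: "i \<in> U" using U_nonempty by blast
  let ?\<tau> = "\<lambda>t. - of_bool (n t j > 0) :: real"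
  have "?\<tau> t = ?\<tau> i"
  proof (rule connected[of ?\<tau> "\<lambda>l. of_bool (l = j)"])
    fix t l assume tl: "n t l > 0"
    show "?\<tau> t + of_bool (l = j) = 0"
    proof (cases "t \<in> U")
      case True thus ?thesis using tl U0[of t] by auto
    next
      case False
      then obtain j0 where "\<forall>j. n t j = of_bool (j = j0)" using n_nonU by blast
      thus ?thesis using tl by auto
    qed
  qed
  thus False using t i U0 by simp
qed

lemma q_nonneg: "q \<beta> \<ge> 0"
proof -
  have "(\<Sum>t\<in>UNIV. \<Sum>j\<in>UNIV. real (n t j) * (0 - m \<beta> t + \<beta> j)\<^sup>2) \<ge> 0"
    by (intro sum_nonneg) simp
  thus ?thesis unfolding model_norm by simp
qed

lemma sum_UNIV_split: "(\<Sum>t\<in>UNIV. f t) = (\<Sum>t\<in>U. f t) + (\<Sum>t\<in>- U. f t :: real)"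
  by (subst sum.union_disjoint[symmetric]) auto

lemma sum_block_split: "real k = d j + (\<Sum>t\<in>- U. real (n t j))"
  using sum_n_block[of j] by (simp add: sum_UNIV_split d_def)

text \<open>For an integer, n <= n^2, so a treatment occurring twice in the block only lowers the
  diagonal entry. Singly replicated treatments cancel against the same number of units of
  \<open>k\<close>.\<close>

lemma C_diag_le: "C j j \<le> d j / 2"
proof -
  have "(\<Sum>t\<in>UNIV. r t * y t j * y t j) = (\<Sum>t\<in>U. r t * y t j * y t j) + (\<Sum>t\<in>- U. r t * y t j * y t j)"
    by (rule sum_UNIV_split)
  moreover have "(\<Sum>t\<in>U. r t * y t j * y t j) \<ge> (\<Sum>t\<in>U. real (n t j) / 2)"
  proof (rule sum_mono)
    fix t assume "t \<in> U"
    moreover have "real (n t j) \<le> (real (n t j))\<^sup>2"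
      by (cases "n t j") (auto simp: power2_eq_square)
    ultimately show "real (n t j) / 2 \<le> r t * y t j * y t j"
      by (simp add: y_def r_def power2_eq_square)
  qed
  moreover have "(\<Sum>t\<in>- U. r t * y t j * y t j) = (\<Sum>t\<in>- U. real (n t j))"
  proof (rule sum.cong)
    fix t assume t: "t \<in> - U"
    then obtain j0 where "\<forall>j. n t j = of_bool (j = j0)" using n_nonU by blast
    thus "r t * y t j * y t j = real (n t j)" using t by (simp add: y_def r_def)
  qed simp
  ultimately show ?thesis
    using sum_block_split[of j] by (simp add: C_def d_def flip: sum_divide_distrib)
qed

lemma sum_d: "(\<Sum>j\<in>UNIV. d j) = 2 * real (card U)"
proof -
  have "(\<Sum>j\<in>UNIV. d j) = (\<Sum>t\<in>U. \<Sum>j\<in>UNIV. real (n t j))"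
    unfolding d_def by (rule sum.swap)
  thus ?thesis by (simp add: sum_n r_def)
qed

lemma number_of_plots: "real CARD('j) * real k = 2 * real (card U) + real (card (- U))"
proof -
  have "(\<Sum>j\<in>(UNIV::'j set). real k) = (\<Sum>j\<in>UNIV. d j) + (\<Sum>j\<in>UNIV. \<Sum>t\<in>- U. real (n t j))"
    unfolding sum.distrib[symmetric] by (intro sum.cong refl sum_block_split)
  also have "(\<Sum>j\<in>UNIV. \<Sum>t\<in>- U. real (n t j)) = (\<Sum>t\<in>- U. \<Sum>j\<in>UNIV. real (n t j))"
    by (rule sum.swap)
  finally show ?thesis by (simp add: sum_d sum_n r_def)
qed

end

section \<open>Variances of contrasts between twice-replicated treatments\<close>

text \<open>\<open>v s t\<close> stands for the squared norm of the coefficients of the BLUE, that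
  is, its variance in units of the error variance. The assumption \<open>dual\<close> separates the
  matrix argument from the probability model.\<close>

locale incidence_variances = incidence n U k
  for n :: "'t::finite \<Rightarrow> 'j::finite \<Rightarrow> nat" and U k +
  fixes v :: "'t \<Rightarrow> 't \<Rightarrow> real"
  assumes dual: "\<And>s t \<tau> \<beta>. s \<noteq> t \<Longrightarrow>
    v s t \<ge> 2 * (\<tau> s - \<tau> t) - (\<Sum>t\<in>UNIV. \<Sum>j\<in>UNIV. real (n t j) * (\<tau> t + \<beta> j)\<^sup>2)"
begin

text \<open>All pairs use the same scale \<open>\<alpha>\<close>, so the total cost is
  \<open>\<alpha>\<^sup>2\<close> times the sum of the \<open>E s t\<close>. That sum is at most
  \<open>2 * u * T\<close>, with equality when no treatment of \<open>U\<close> is repeated in a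
  block.\<close>

lemma sum_variances_UU:
  assumes "real CARD('j) < 2 * real (card U)"
  shows "(\<Sum>s\<in>U. \<Sum>t\<in>U. if s = t then 0 else v s t)
    \<ge> 2 * real (card U) * (real (card U) - 1)\<^sup>2 / (2 * real (card U) - real CARD('j))"
proof -
  define u where "u = real (card U)"
  define T where "T = 2 * u - real CARD('j)"
  \<comment> \<open>The indicator of \<open>s\<close>, centred by its mean over the
    \<open>d j\<close> plots of block \<open>j\<close> that carry treatments in
    \<open>U\<close>.\<close>
  define a where "a i j s = of_bool (i = s) - real (n s j) / d j" for i j s
  define E where "E s t = (\<Sum>i\<in>U. \<Sum>j\<in>UNIV. real (n i j) * (a i j s - a i j t)\<^sup>2)" for s t
  have T: "T > 0" using assms by (simp add: T_def u_def)
  have dp: "d j > 0" for j using d_pos[of j] by simp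
  have v: "(if s = t then 0 else v s t) \<ge> (if s = t then 0 else 4 * \<alpha>) - \<alpha>\<^sup>2 * E s t"
    if st: "s \<in> U" "t \<in> U" for s t \<alpha>
  proof (cases "s = t")
    case True
    thus ?thesis by (simp add: E_def)
  next
    case False
    \<comment> \<open>Minus the mean, over the \<open>U\<close> plots of block \<open>j\<close>, of
      the treatment effects chosen next. Each treatment outside \<open>U\<close> cancels the block
      effect on its only plot and costs nothing.\<close>
    define \<beta> where "\<beta> j = \<alpha> * (real (n t j) - real (n s j)) / d j" for j
    define \<tau> where "\<tau> i = (if i \<in> U then \<alpha> * (of_bool (i = s) - of_bool (i = t)) else - m \<beta> i)" for i
    have "(\<Sum>j\<in>UNIV. real (n i j) * (\<tau> i + \<beta> j)\<^sup>2)
        = (if i \<in> U then \<alpha>\<^sup>2 * (\<Sum>j\<in>UNIV. real (n i j) * (a i j s - a i j t)\<^sup>2) else 0)" for i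
    proof (cases "i \<in> U")
      case True
      have "\<tau> i + \<beta> j = \<alpha> * (a i j s - a i j t)" for j
        using True dp[of j] by (simp add: \<tau>_def \<beta>_def a_def field_simps)
      thus ?thesis using True
        by (simp add: power_mult_distrib sum_distrib_left mult_ac)
    next
      case False
      then obtain j0 where j0: "\<forall>j. n i j = of_bool (j = j0)" using n_nonU by blast
      have "m \<beta> i = \<beta> j0" using False by (simp add: m_def y_def r_def j0)
      thus ?thesis using False j0 by (simp add: \<tau>_def)
    qed
    hence "(\<Sum>i\<in>UNIV. \<Sum>j\<in>UNIV. real (n i j) * (\<tau> i + \<beta> j)\<^sup>2) = \<alpha>\<^sup>2 * E s t"
      by (simp add: E_def sum_distrib_left flip: sum.inter_restrict)
    thus ?thesis using dual[OF False, of \<tau> \<beta>] False st by (simp add: \<tau>_def)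
  qed
  \<comment> \<open>The usual formula for a sum of squared differences over all pairs; the mixed
    products drop out because the numbers \<open>a i j s\<close> sum to zero over
    \<open>s\<close>.\<close>
  have sq: "(\<Sum>s\<in>U. \<Sum>t\<in>U. (a i j s - a i j t)\<^sup>2) = 2 * u * (\<Sum>s\<in>U. (a i j s)\<^sup>2)" if "i \<in> U" for i j
  proof -
    have "(\<Sum>s\<in>U. a i j s) = 0"
      using dp[of j] that by (simp add: a_def sum_subtractf d_def flip: sum_divide_distrib)
    hence z: "(\<Sum>s\<in>U. \<Sum>t\<in>U. a i j s * a i j t) = 0" by (simp flip: sum_product)
    have "(\<Sum>s\<in>U. \<Sum>t\<in>U. (a i j s - a i j t)\<^sup>2)
      = (\<Sum>s\<in>U. \<Sum>t\<in>U. (a i j s)\<^sup>2 + (a i j t)\<^sup>2 - 2 * (a i j s * a i j t))"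
      by (simp add: power2_diff mult.assoc)
    also have "\<dots> = 2 * u * (\<Sum>s\<in>U. (a i j s)\<^sup>2) - 2 * (\<Sum>s\<in>U. \<Sum>t\<in>U. a i j s * a i j t)"
      by (simp add: sum.distrib sum_subtractf u_def sum_distrib_left mult.assoc)
    finally show ?thesis using z by simp
  qed
  have col: "(\<Sum>i\<in>U. real (n i j) * (a i j s)\<^sup>2) \<le> real (n s j) - real (n s j) / d j" if "s \<in> U" for s j
  proof -
    define f where "f = real (n s j) / d j"
    have "real (n i j) * (a i j s)\<^sup>2 = (if i = s then real (n s j) * (1 - 2 * f) else 0) + real (n i j) * f\<^sup>2" for i
      by (simp add: a_def f_def power2_eq_square algebra_simps)
    hence "(\<Sum>i\<in>U. real (n i j) * (a i j s)\<^sup>2) = real (n s j) * (1 - 2 * f) + d j * f\<^sup>2"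
      using that by (simp add: sum.distrib d_def sum_distrib_right)
    also have "\<dots> = real (n s j) - (real (n s j))\<^sup>2 / d j"
      using dp[of j] by (simp add: f_def power2_eq_square field_simps)
    also have "\<dots> \<le> real (n s j) - real (n s j) / d j"
    proof -
      have "real (n s j) \<le> (real (n s j))\<^sup>2"
        by (cases "n s j") (auto simp: power2_eq_square)
      thus ?thesis using dp[of j] by (simp add: divide_right_mono)
    qed
    finally show ?thesis .
  qed
  \<comment> \<open>The sums over \<open>s\<close> and \<open>t\<close> are moved inside to apply
    \<open>sq\<close>; afterwards the sum over \<open>i\<close> is moved inside to apply
    \<open>col\<close>.\<close>
  have "(\<Sum>s\<in>U. \<Sum>t\<in>U. E s t) = (\<Sum>s\<in>U. \<Sum>i\<in>U. \<Sum>t\<in>U. \<Sum>j\<in>UNIV. real (n i j) * (a i j s - a i j t)\<^sup>2)"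
    unfolding E_def by (intro sum.cong refl sum.swap)
  also have "\<dots> = (\<Sum>i\<in>U. \<Sum>s\<in>U. \<Sum>j\<in>UNIV. \<Sum>t\<in>U. real (n i j) * (a i j s - a i j t)\<^sup>2)"
    by (subst sum.swap) (intro sum.cong refl sum.swap)
  also have "\<dots> = (\<Sum>i\<in>U. \<Sum>j\<in>UNIV. real (n i j) * (\<Sum>s\<in>U. \<Sum>t\<in>U. (a i j s - a i j t)\<^sup>2))"
    unfolding sum_distrib_left by (intro sum.cong refl sum.swap)
  also have "\<dots> = 2 * u * (\<Sum>i\<in>U. \<Sum>j\<in>UNIV. \<Sum>s\<in>U. real (n i j) * (a i j s)\<^sup>2)"
    by (simp add: sq sum_distrib_left mult_ac)
  also have "(\<Sum>i\<in>U. \<Sum>j\<in>UNIV. \<Sum>s\<in>U. real (n i j) * (a i j s)\<^sup>2)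
      = (\<Sum>j\<in>UNIV. \<Sum>i\<in>U. \<Sum>s\<in>U. real (n i j) * (a i j s)\<^sup>2)"
    by (rule sum.swap)
  also have "\<dots> = (\<Sum>j\<in>UNIV. \<Sum>s\<in>U. \<Sum>i\<in>U. real (n i j) * (a i j s)\<^sup>2)"
    by (intro sum.cong refl sum.swap)
  also have "2 * u * \<dots> \<le> 2 * u * (\<Sum>j\<in>UNIV. \<Sum>s\<in>U. real (n s j) - real (n s j) / d j)"
    by (intro mult_left_mono sum_mono col) (simp_all add: u_def)
  \<comment> \<open>Every block loses exactly one degree of freedom, since \<open>d j\<close> is
    positive by \<open>d_pos\<close>. This is the source of the denominator 2u - b.\<close>
  also have "(\<Sum>j\<in>UNIV. \<Sum>s\<in>U. real (n s j) - real (n s j) / d j) = T"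
  proof -
    have "(\<Sum>s\<in>U. real (n s j) - real (n s j) / d j) = d j - 1" for j
      using dp[of j] by (simp add: sum_subtractf d_def flip: sum_divide_distrib)
    thus ?thesis by (simp add: sum_subtractf sum_d T_def u_def)
  qed
  finally have E: "(\<Sum>s\<in>U. \<Sum>t\<in>U. E s t) \<le> 2 * u * T" .
  \<comment> \<open>The maximizer of the quadratic \<open>4 * \<alpha> * (u * (u - 1)) -
    \<alpha>\<^sup>2 * (2 * u * T)\<close>.\<close>
  define \<alpha> where "\<alpha> = (u - 1) / T"
  have "2 * u * (u - 1)\<^sup>2 / T = 4 * \<alpha> * (u * (u - 1)) - \<alpha>\<^sup>2 * (2 * u * T)"
    using T by (simp add: \<alpha>_def power2_eq_square field_simps)
  also have "\<dots> \<le> 4 * \<alpha> * (u * (u - 1)) - \<alpha>\<^sup>2 * (\<Sum>s\<in>U. \<Sum>t\<in>U. E s t)"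
    using E by (intro diff_left_mono mult_left_mono) auto
  also have "\<dots> = (\<Sum>s\<in>U. \<Sum>t\<in>U. (if s = t then 0 else 4 * \<alpha>) - \<alpha>\<^sup>2 * E s t)"
  proof -
    have "(\<Sum>t\<in>U. if s = t then 0 else 4 * \<alpha>) = 4 * \<alpha> * (u - 1)" if "s \<in> U" for s
    proof -
      have "(\<Sum>t\<in>U. if s = t then 0 else 4 * \<alpha>) = (\<Sum>t\<in>U. 4 * \<alpha> - (if s = t then 4 * \<alpha> else 0))"
        by (intro sum.cong) auto
      thus ?thesis using that by (simp add: sum_subtractf u_def algebra_simps)
    qed
    thus ?thesis by (simp add: sum_subtractf sum_distrib_left u_def)
  qed
  also have "\<dots> \<le> (\<Sum>s\<in>U. \<Sum>t\<in>U. if s = t then 0 else v s t)"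
    by (intro sum_mono v)
  finally show ?thesis by (simp add: u_def T_def)
qed

section \<open>Sum over all ordered pairs of treatments\<close>

lemma sum_variances:
  assumes "real CARD('j) < 2 * real (card U)"
  shows "(\<Sum>s\<in>UNIV. \<Sum>t\<in>UNIV. if s = t then 0 else v s t)
    \<ge> 2 * A_bound (card U) CARD('j) k (card (- U))"
proof -
  define u where "u = real (card U)"
  define w where "w = real (card (- U))"
  define b where "b = real CARD('j)"
  have b1: "b \<ge> 1" unfolding b_def using one_le_card_finite[where 'a = 'j] by simp
  have u: "u > 0" using U_nonempty by (simp add: u_def card_gt_0_iff)
  have bk: "b * real k = 2 * u + w" using number_of_plots by (simp add: b_def u_def w_def)
  obtain G where Gs: "\<And>j l. G j l = G l j" and Gr: "\<And>j. (\<Sum>l\<in>UNIV. G j l) = 0"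
    and CG: "\<And>j l. (\<Sum>i\<in>UNIV. C j i * G i l) = of_bool (j = l) - 1 / b"
    unfolding b_def by (rule laplacian_pseudoinverse[of C, OF C_sym C_row C_kernel]) auto
  define B where "B x z = (\<Sum>j\<in>UNIV. \<Sum>l\<in>UNIV. G j l * x j * z l)" for x z :: "'j \<Rightarrow> real"
  \<comment> \<open>This is s_j, the number of plots of block \<open>j\<close> with singly
    replicated treatments.\<close>
  define sv where "sv j = real k - d j" for j
  have Bs: "B x z = B z x" for x z
    unfolding B_def by (subst sum.swap) (simp add: Gs mult_ac)
  have Bsum: "(\<Sum>s\<in>X. \<Sum>t\<in>Y. B (f s) (g t)) = B (\<lambda>j. \<Sum>s\<in>X. f s j) (\<lambda>j. \<Sum>t\<in>Y. g t j)"
    for X Y :: "'t set" and f g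
  proof -
    have "(\<Sum>s\<in>X. \<Sum>t\<in>Y. B (f s) (g t)) = (\<Sum>s\<in>X. \<Sum>j\<in>UNIV. \<Sum>t\<in>Y. \<Sum>l\<in>UNIV. G j l * f s j * g t l)"
      unfolding B_def by (intro sum.cong refl sum.swap)
    also have "\<dots> = (\<Sum>j\<in>UNIV. \<Sum>s\<in>X. \<Sum>l\<in>UNIV. \<Sum>t\<in>Y. G j l * f s j * g t l)"
      by (subst sum.swap) (intro sum.cong refl sum.swap)
    also have "\<dots> = (\<Sum>j\<in>UNIV. \<Sum>l\<in>UNIV. \<Sum>s\<in>X. \<Sum>t\<in>Y. G j l * f s j * g t l)"
      by (intro sum.cong refl sum.swap)
    also have "\<dots> = B (\<lambda>j. \<Sum>s\<in>X. f s j) (\<lambda>j. \<Sum>t\<in>Y. g t j)"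
      unfolding B_def mult.assoc sum_product unfolding sum_distrib_left ..
    finally show ?thesis .
  qed
  have q_alt: "q \<beta> = (\<Sum>j\<in>UNIV. \<beta> j * (\<Sum>l\<in>UNIV. C j l * \<beta> l))" for \<beta>
    unfolding q_def sum_distrib_left by (simp add: mult_ac)
  have pair: "v s t \<ge> 1 / r s + 1 / r t + B (y s) (y s) + B (y t) (y t) - 2 * B (y s) (y t)"
    if st: "s \<noteq> t" for s t
  proof -
    define x where "x j = y t j - y s j" for j
    define \<beta> where "\<beta> j = (\<Sum>l\<in>UNIV. G j l * x l)" for j
    define a where "a i = (if i = s then 1 / r s else if i = t then - 1 / r t else 0)" for i
    have sx: "(\<Sum>j\<in>UNIV. x j) = 0" by (simp add: x_def sum_subtractf sum_y)
    have xB: "(\<Sum>j\<in>UNIV. x j * \<beta> j) = B x x"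
      by (simp add: \<beta>_def B_def sum_distrib_left mult_ac)
    have "(\<Sum>l\<in>UNIV. C j l * \<beta> l) = x j" for j
    proof -
      have "(\<Sum>l\<in>UNIV. C j l * \<beta> l) = (\<Sum>i\<in>UNIV. (\<Sum>l\<in>UNIV. C j l * G l i) * x i)"
        unfolding \<beta>_def sum_distrib_left sum_distrib_right
        by (subst sum.swap) (simp add: mult_ac)
      also have "\<dots> = (\<Sum>i\<in>UNIV. (if j = i then x i else 0) - 1 / b * x i)"
        unfolding CG by (intro sum.cong) (auto simp: left_diff_distrib)
      also have "\<dots> = x j" using sx by (simp add: sum_subtractf flip: sum_distrib_left sum_divide_distrib)
      finally show ?thesis .
    qed
    hence qB: "q \<beta> = B x x" unfolding q_alt using xB by (simp add: mult.commute)
    have "m \<beta> t - m \<beta> s = B x x"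
      unfolding m_def xB[symmetric] x_def by (simp add: left_diff_distrib sum_subtractf)
    moreover have "(\<Sum>i\<in>UNIV. r i * (a i)\<^sup>2) = 1 / r s + 1 / r t"
    proof -
      have "r i * (a i)\<^sup>2 = (if i = s then 1 / r s else 0) + (if i = t then 1 / r t else 0)" for i
        using st r_pos[of s] r_pos[of t] by (auto simp: a_def power2_eq_square)
      thus ?thesis by (simp add: sum.distrib)
    qed
    moreover have "B x x = B (y s) (y s) + B (y t) (y t) - B (y s) (y t) - B (y t) (y s)"
      by (simp add: B_def x_def algebra_simps sum.distrib sum_subtractf)
    ultimately show ?thesis
      using dual[OF st, of "\<lambda>i. a i - m \<beta> i" \<beta>] st
      unfolding model_norm qB by (simp add: a_def Bs[of "y t" "y s"])
  qed
  have y_nonU: "y t j * y t l = (if j = l then y t j else 0)" if t: "t \<notin> U" for t j l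
  proof -
    obtain j0 where "\<forall>j. n t j = of_bool (j = j0)" using n_nonU[OF t] by blast
    thus ?thesis using t by (auto simp: y_def r_def)
  qed
  have sv: "sv j = (\<Sum>t\<in>- U. y t j)" for j
    using sum_block_split[of j] by (simp add: sv_def y_def r_def)
  have sv_nonneg: "sv j \<ge> 0" for j
    unfolding sv by (intro sum_nonneg) (simp add: y_def r_def)
  have sum_sv: "(\<Sum>j\<in>UNIV. sv j) = w"
    using bk by (simp add: sv_def sum_subtractf sum_d b_def u_def)
  have dU: "(\<Sum>t\<in>U. y t j) = d j / 2" for j
    by (simp add: d_def y_def r_def flip: sum_divide_distrib)
  define TS where "TS = (\<Sum>j\<in>UNIV. sv j * G j j)"
  define TT where "TT = (\<Sum>j\<in>UNIV. G j j)"
  \<comment> \<open>A singly replicated treatment has a unit vector \<open>y t\<close>, so only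
    diagonal entries of \<open>G\<close> survive.\<close>
  have W_diag: "(\<Sum>t\<in>- U. B (y t) (y t)) = TS"
  proof -
    have "B (y t) (y t) = (\<Sum>j\<in>UNIV. y t j * G j j)" if "t \<in> - U" for t
    proof -
      have "G j l * y t j * y t l = (if j = l then y t j * G j j else 0)" for j l
        using that by (simp add: mult.assoc y_nonU)
      thus ?thesis by (simp add: B_def)
    qed
    thus ?thesis
      unfolding TS_def sv sum_distrib_right by (subst sum.swap) simp
  qed
  \<comment> \<open>Twice the sum of the outer products of the \<open>y t\<close> over
    \<open>U\<close> is diag(d) - C. Pairing with \<open>G\<close> uses tr(CG) = b - 1 and
    \<open>d j = real k - sv j\<close>.\<close>
  have U_diag: "(\<Sum>t\<in>U. B (y t) (y t)) = (real k * TT - TS - (b - 1)) / 2"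
  proof -
    have UC: "2 * (\<Sum>t\<in>U. y t j * y t l) = (if j = l then d j else 0) - C j l" for j l
    proof -
      have "(\<Sum>t\<in>UNIV. r t * y t j * y t l)
          = 2 * (\<Sum>t\<in>U. y t j * y t l) + (if j = l then sv j else 0)"
        by (simp add: sum_UNIV_split r_def sv y_nonU sum_distrib_left mult.assoc)
      thus ?thesis by (simp add: C_def sv_def)
    qed
    have "2 * (\<Sum>t\<in>U. B (y t) (y t)) = (\<Sum>j\<in>UNIV. \<Sum>l\<in>UNIV. G j l * (2 * (\<Sum>t\<in>U. y t j * y t l)))"
    proof -
      have "(\<Sum>t\<in>U. B (y t) (y t)) = (\<Sum>j\<in>UNIV. \<Sum>t\<in>U. \<Sum>l\<in>UNIV. G j l * y t j * y t l)"
        unfolding B_def by (rule sum.swap)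
      also have "\<dots> = (\<Sum>j\<in>UNIV. \<Sum>l\<in>UNIV. \<Sum>t\<in>U. G j l * y t j * y t l)"
        by (intro sum.cong refl sum.swap)
      finally show ?thesis by (simp add: sum_distrib_left mult_ac)
    qed
    also have "\<dots> = (\<Sum>j\<in>UNIV. \<Sum>l\<in>UNIV. (if j = l then d j * G j j else 0) - C j l * G l j)"
      unfolding UC by (intro sum.cong) (auto simp: algebra_simps Gs)
    also have "\<dots> = (\<Sum>j\<in>UNIV. d j * G j j) - (b - 1)"
      using b1 by (simp add: sum_subtractf CG flip: b_def) (simp add: field_simps)
    also have "(\<Sum>j\<in>UNIV. d j * G j j) = real k * TT - TS"
      by (simp add: TT_def TS_def sv_def sum_distrib_left left_diff_distrib flip: sum_subtractf)
    finally show ?thesis by simp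
  qed
  \<comment> \<open>The \<open>y t\<close> with \<open>t\<close> in \<open>U\<close> add up to half
    of \<open>real k - sv j\<close>, and \<open>G\<close> annihilates the constant part.\<close>
  have cross: "(\<Sum>s\<in>U. \<Sum>t\<in>- U. B (y s) (y t)) = - B sv sv / 2"
  proof -
    have "(\<Sum>s\<in>U. \<Sum>t\<in>- U. B (y s) (y t)) = B sv (\<lambda>j. d j / 2)"
      unfolding Bsum dU sv[symmetric] by (rule Bs)
    also have "\<dots> = (\<Sum>j\<in>UNIV. real k / 2 * sv j * (\<Sum>l\<in>UNIV. G j l)) - B sv sv / 2"
      unfolding B_def sum_distrib_left sum_divide_distrib sum_subtractf[symmetric]
      by (intro sum.cong) (simp_all add: sv_def field_simps)
    finally show ?thesis by (simp add: Gr)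
  qed
  have WW: "(\<Sum>s\<in>- U. \<Sum>t\<in>- U. if s = t then 0 else v s t) \<ge> 2 * w * (w - 1) + 2 * w * TS - 2 * B sv sv"
  proof -
    have "(\<Sum>t\<in>- U. if s = t then 0 else 2) = 2 * (w - 1)" if "s \<in> - U" for s
    proof -
      have "(\<Sum>t\<in>- U. if s = t then 0 else 2) = (\<Sum>t\<in>- U. 2 - (if s = t then 2 else 0 :: real))"
        by (intro sum.cong) auto
      thus ?thesis using that by (simp add: sum_subtractf w_def)
    qed
    \<comment> \<open>For \<open>s = t\<close> the \<open>B\<close> terms cancel, so the diagonal
      can be included at no cost.\<close>
    hence "2 * w * (w - 1) + 2 * w * TS - 2 * B sv sv
      = (\<Sum>s\<in>- U. \<Sum>t\<in>- U. (if s = t then 0 else 2) + B (y s) (y s) + B (y t) (y t) - 2 * B (y s) (y t))"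
      by (simp add: sum.distrib sum_subtractf W_diag Bsum w_def
          flip: sum_distrib_left sv)
    also have "\<dots> \<le> (\<Sum>s\<in>- U. \<Sum>t\<in>- U. if s = t then 0 else v s t)"
    proof (intro sum_mono)
      fix s t assume "s \<in> - U" "t \<in> - U"
      thus "(if s = t then 0 else 2) + B (y s) (y s) + B (y t) (y t) - 2 * B (y s) (y t)
          \<le> (if s = t then 0 else v s t)"
        using pair[of s t] by (auto simp: r_def)
    qed
    finally show ?thesis .
  qed
  define H where "H = 3 / 2 * u * w + w * ((real k * TT - TS - (b - 1)) / 2) + u * TS + B sv sv"
  have H: "H = (\<Sum>s\<in>U. \<Sum>t\<in>- U. 3 / 2 + B (y s) (y s) + B (y t) (y t) - 2 * B (y s) (y t))"
    using cross by (simp add: H_def sum.distrib sum_subtractf W_diag U_diag u_def w_def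
        flip: sum_distrib_left) (simp add: field_simps)
  have UW: "(\<Sum>s\<in>U. \<Sum>t\<in>- U. if s = t then 0 else v s t) \<ge> H"
    unfolding H
  proof (intro sum_mono)
    fix s t assume st: "s \<in> U" "t \<in> - U"
    hence "s \<noteq> t" by auto
    thus "3 / 2 + B (y s) (y s) + B (y t) (y t) - 2 * B (y s) (y t) \<le> (if s = t then 0 else v s t)"
      using pair[of s t] st by (simp add: r_def)
  qed
  have "(\<Sum>s\<in>U. \<Sum>t\<in>- U. if t = s then 0 else v t s) \<ge> H"
    unfolding H
  proof (intro sum_mono)
    fix s t assume st: "s \<in> U" "t \<in> - U"
    hence "t \<noteq> s" by auto
    thus "3 / 2 + B (y s) (y s) + B (y t) (y t) - 2 * B (y s) (y t) \<le> (if t = s then 0 else v t s)"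
      using pair[of t s] st by (simp add: r_def Bs[of "y t" "y s"])
  qed
  hence WU: "(\<Sum>t\<in>- U. \<Sum>s\<in>U. if t = s then 0 else v t s) \<ge> H"
    by (subst sum.swap)
  have UU: "(\<Sum>s\<in>U. \<Sum>t\<in>U. if s = t then 0 else v s t) \<ge> 2 * u * (u - 1)\<^sup>2 / (2 * u - b)"
    using sum_variances_UU[OF assms] by (simp add: u_def b_def)
  \<comment> \<open>This value maximizes both resulting bounds: 2 g (b - 1) - g^2 u for
    \<open>TT\<close>, and \<open>w\<close> times the same expression for
    \<open>b * TS\<close>.\<close>
  define \<gamma> where "\<gamma> = (b - 1) / u"
  \<comment> \<open>Nonnegativity of \<open>q\<close> at g e_j - G e_j, where g is
    \<open>\<gamma>\<close>, together with GCG = G and \<open>C_diag_le\<close>.\<close>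
  have Gjj: "G j j \<ge> 2 * \<gamma> * (1 - 1 / b) - \<gamma>\<^sup>2 * d j / 2" for j
  proof -
    let ?z = "\<lambda>i. (if i = j then \<gamma> else 0) - G i j"
    have "(\<Sum>l\<in>UNIV. C i l * ?z l) = \<gamma> * C i j - (of_bool (i = j) - 1 / b)" for i
    proof -
      have "(\<Sum>l\<in>UNIV. C i l * ?z l) = (\<Sum>l\<in>UNIV. (if l = j then \<gamma> * C i j else 0) - C i l * G l j)"
        by (intro sum.cong) (auto simp: algebra_simps)
      thus ?thesis by (simp add: sum_subtractf CG)
    qed
    hence "q ?z = (\<Sum>i\<in>UNIV. ?z i * (\<gamma> * C i j - (of_bool (i = j) - 1 / b)))"
      unfolding q_alt by simp
    also have "\<dots> = (\<Sum>i\<in>UNIV. (if i = j then \<gamma>\<^sup>2 * C j j - \<gamma> * (1 - 1 / b) + G j j else 0)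
        - \<gamma> * (C j i * G i j) - G i j / b)"
      by (intro sum.cong) (auto simp: C_sym power2_eq_square algebra_simps)
    also have "\<dots> = \<gamma>\<^sup>2 * C j j - 2 * \<gamma> * (1 - 1 / b) + G j j"
    proof -
      have "(\<Sum>i\<in>UNIV. G i j) = (\<Sum>i\<in>UNIV. G j i)" by (intro sum.cong refl Gs)
      hence "(\<Sum>i\<in>UNIV. G i j) = 0" by (simp add: Gr)
      thus ?thesis
        unfolding sum_subtractf sum_distrib_left[symmetric] sum_divide_distrib[symmetric] CG
        by simp
    qed
    finally have "\<gamma>\<^sup>2 * C j j - 2 * \<gamma> * (1 - 1 / b) + G j j \<ge> 0"
      using q_nonneg[of ?z] by simp
    moreover have "\<gamma>\<^sup>2 * C j j \<le> \<gamma>\<^sup>2 * (d j / 2)"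
      by (intro mult_left_mono C_diag_le) simp
    ultimately show ?thesis by simp
  qed
  have TT: "TT \<ge> (b - 1)\<^sup>2 / u"
  proof -
    have "(b - 1)\<^sup>2 / u = 2 * \<gamma> * (b - 1) - \<gamma>\<^sup>2 * u"
      using u by (simp add: \<gamma>_def power2_eq_square field_simps)
    also have "\<dots> = (\<Sum>j\<in>(UNIV::'j set). 2 * \<gamma> * (1 - 1 / b)) - \<gamma>\<^sup>2 / 2 * (\<Sum>j\<in>UNIV. d j)"
      using b1 by (simp add: sum_d u_def flip: b_def) (simp add: field_simps)
    also have "\<dots> = (\<Sum>j\<in>UNIV. 2 * \<gamma> * (1 - 1 / b) - \<gamma>\<^sup>2 * d j / 2)"
      by (simp add: sum_subtractf sum_distrib_left)
    also have "\<dots> \<le> TT" unfolding TT_def by (intro sum_mono Gjj)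
    finally show ?thesis .
  qed
  have TS: "b * TS \<ge> w * (b - 1)\<^sup>2 / u"
  proof -
    \<comment> \<open>Cauchy-Schwarz, as nonnegativity of the spread of the \<open>d j\<close> about
      their mean 2u/b.\<close>
    have d2: "(\<Sum>j\<in>UNIV. (d j)\<^sup>2) \<ge> (2 * u)\<^sup>2 / b"
    proof -
      have "(\<Sum>j\<in>UNIV. (d j - 2 * u / b)\<^sup>2) \<ge> 0" by (intro sum_nonneg) simp
      also have "(\<Sum>j\<in>UNIV. (d j - 2 * u / b)\<^sup>2)
          = (\<Sum>j\<in>UNIV. (d j)\<^sup>2) - 2 * (2 * u / b) * (\<Sum>j\<in>UNIV. d j) + b * (2 * u / b)\<^sup>2"
        by (simp add: power2_diff sum.distrib sum_subtractf sum_distrib_left sum_divide_distrib b_def mult_ac)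
      also have "\<dots> = (\<Sum>j\<in>UNIV. (d j)\<^sup>2) - (2 * u)\<^sup>2 / b"
        using b1 by (simp add: sum_d power2_eq_square field_simps flip: u_def)
      finally show ?thesis by simp
    qed
    have "(\<Sum>j\<in>UNIV. sv j * d j) = real k * (\<Sum>j\<in>UNIV. d j) - (\<Sum>j\<in>UNIV. (d j)\<^sup>2)"
      by (simp add: sv_def left_diff_distrib sum_subtractf sum_distrib_left power2_eq_square)
    also have "\<dots> \<le> real k * (2 * u) - (2 * u)\<^sup>2 / b" using d2 by (simp add: sum_d u_def)
    also have "\<dots> = 2 * u * w / b"
    proof -
      have "real k * (2 * u) - (2 * u)\<^sup>2 / b = 2 * u * (b * real k - 2 * u) / b"
        using b1 by (simp add: power2_eq_square field_simps)
      thus ?thesis unfolding bk by simp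
    qed
    finally have sd: "(\<Sum>j\<in>UNIV. sv j * d j) \<le> 2 * u * w / b" .
    have "w * (b - 1)\<^sup>2 / u = b * (2 * \<gamma> * (1 - 1 / b) * w - \<gamma>\<^sup>2 / 2 * (2 * u * w / b))"
      using u b1 by (simp add: \<gamma>_def power2_eq_square field_simps)
    also have "\<dots> \<le> b * (2 * \<gamma> * (1 - 1 / b) * w - \<gamma>\<^sup>2 / 2 * (\<Sum>j\<in>UNIV. sv j * d j))"
      using sd b1 by (intro mult_left_mono diff_left_mono) auto
    also have "2 * \<gamma> * (1 - 1 / b) * w - \<gamma>\<^sup>2 / 2 * (\<Sum>j\<in>UNIV. sv j * d j)
      = (\<Sum>j\<in>UNIV. sv j * (2 * \<gamma> * (1 - 1 / b) - \<gamma>\<^sup>2 * d j / 2))"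
      unfolding sum_sv[symmetric] sum_distrib_left sum_subtractf[symmetric]
      by (intro sum.cong) (simp_all add: algebra_simps)
    also have "b * \<dots> \<le> b * TS"
      unfolding TS_def using b1 by (intro mult_left_mono sum_mono Gjj sv_nonneg) auto
    finally show ?thesis .
  qed
  have "2 * A_bound (card U) CARD('j) k (card (- U))
      = w * (3 * u + 2 * w - b - 1) + 2 * u * (u - 1)\<^sup>2 / (2 * u - b)
        + real k * (w * (b - 1)\<^sup>2 / u) + real k * w * ((b - 1)\<^sup>2 / u)"
    by (simp add: A_bound_def u_def w_def b_def)
  also have "\<dots> \<le> w * (3 * u + 2 * w - b - 1) + 2 * u * (u - 1)\<^sup>2 / (2 * u - b)
        + real k * (b * TS) + real k * w * TT"
    using TS TT by (intro add_mono mult_left_mono order_refl) (auto simp: w_def)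
  also have "\<dots> = w * (3 * u + 2 * w - b - 1) + 2 * u * (u - 1)\<^sup>2 / (2 * u - b)
        + (2 * u + w) * TS + real k * w * TT"
    unfolding bk[symmetric] by simp
  \<comment> \<open>The terms \<open>B sv sv\<close> cancel: each of the two mixed orders adds one
    and the pairs outside \<open>U\<close> remove two. Only the traces \<open>TS\<close> and
    \<open>TT\<close> remain.\<close>
  also have "\<dots> = 2 * u * (u - 1)\<^sup>2 / (2 * u - b) + 2 * H + (2 * w * (w - 1) + 2 * w * TS - 2 * B sv sv)"
    by (simp add: H_def field_simps)
  also have "\<dots> \<le> (\<Sum>s\<in>U. \<Sum>t\<in>U. if s = t then 0 else v s t)
      + ((\<Sum>s\<in>U. \<Sum>t\<in>- U. if s = t then 0 else v s t) + (\<Sum>t\<in>- U. \<Sum>s\<in>U. if t = s then 0 else v t s))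
      + (\<Sum>s\<in>- U. \<Sum>t\<in>- U. if s = t then 0 else v s t)"
    using UU UW WU WW by linarith
  also have "\<dots> = (\<Sum>s\<in>UNIV. \<Sum>t\<in>UNIV. if s = t then 0 else v s t)"
    by (simp add: sum_UNIV_split sum.distrib)
  finally show ?thesis .
qed

end

section \<open>Linear estimators in the block model\<close>

lemma sum_over_plots:
  fixes trt :: "'p::finite \<Rightarrow> 't::finite" and blk :: "'p \<Rightarrow> 'j::finite" and F :: "'t \<Rightarrow> 'j \<Rightarrow> real"
  shows "(\<Sum>p\<in>UNIV. F (trt p) (blk p))
    = (\<Sum>t\<in>UNIV. \<Sum>j\<in>UNIV. real (card {p. trt p = t \<and> blk p = j}) * F t j)"
proof -
  have "real (card {p. trt p = t \<and> blk p = j}) * F t j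
      = (\<Sum>p\<in>UNIV. if trt p = t then if blk p = j then F t j else 0 else 0)" for t j
  proof -
    have "(\<Sum>p\<in>UNIV. if trt p = t then if blk p = j then F t j else 0 else 0)
        = (\<Sum>p\<in>UNIV. if trt p = t \<and> blk p = j then F t j else 0)"
      by (intro sum.cong) auto
    thus ?thesis by (simp flip: sum.inter_filter)
  qed
  hence "(\<Sum>t\<in>UNIV. \<Sum>j\<in>UNIV. real (card {p. trt p = t \<and> blk p = j}) * F t j)
     = (\<Sum>t\<in>UNIV. \<Sum>p\<in>UNIV. \<Sum>j\<in>UNIV. if trt p = t then if blk p = j then F t j else 0 else 0)"
    by (simp add: sum.swap[of _ "UNIV::'j set" "UNIV::'p set"])
  also have "\<dots> = (\<Sum>p\<in>UNIV. \<Sum>t\<in>UNIV. \<Sum>j\<in>UNIV. if trt p = t then if blk p = j then F t j else 0 else 0)"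
    by (rule sum.swap)
  also have "\<dots> = (\<Sum>p\<in>UNIV. \<Sum>t\<in>UNIV. if trt p = t then F t (blk p) else 0)"
    by (intro sum.cong refl) auto
  finally show ?thesis by simp
qed

lemma expectation_linear_estimator:
  assumes "block_model blk trt \<sigma> M Y"
  shows "prob_space.expectation (M \<tau> \<beta>) (linear_estimator Y c) = (\<Sum>p\<in>UNIV. c p * (\<tau> (trt p) + \<beta> (blk p)))"
  using assms unfolding block_model_def linear_estimator_def by simp

lemma variance_linear_estimator:
  assumes "block_model blk trt \<sigma> M Y"
  shows "prob_space.variance (M \<tau> \<beta>) (linear_estimator Y c) = \<sigma>\<^sup>2 * (\<Sum>p\<in>UNIV. (c p)\<^sup>2)"
proof -
  interpret prob_space "M \<tau> \<beta>" using assms unfolding block_model_def by blast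
  define Z where "Z p \<omega> = Y p \<omega> - expectation (Y p)" for p \<omega>
  have Y: "integrable (M \<tau> \<beta>) (Y p)" "integrable (M \<tau> \<beta>) (\<lambda>\<omega>. (Y p \<omega>)\<^sup>2)" for p
    using assms unfolding block_model_def by blast+
  have cov: "expectation (\<lambda>\<omega>. Z p \<omega> * Z q \<omega>) = (if p = q then \<sigma>\<^sup>2 else 0)" for p q
    using assms unfolding block_model_def covariance_def Z_def by blast
  have Z2: "integrable (M \<tau> \<beta>) (\<lambda>\<omega>. (Z p \<omega>)\<^sup>2)" for p
    unfolding Z_def power2_diff using Y[of p] by simp
  \<comment> \<open>Products are dominated by sums of squares; their integrability lets the
    expectation pass through the double sum.\<close>
  have ZZ: "integrable (M \<tau> \<beta>) (\<lambda>\<omega>. Z p \<omega> * Z q \<omega>)" for p q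
  proof (rule Bochner_Integration.integrable_bound)
    show "integrable (M \<tau> \<beta>) (\<lambda>\<omega>. (Z p \<omega>)\<^sup>2 + (Z q \<omega>)\<^sup>2)" using Z2 by simp
    show "(\<lambda>\<omega>. Z p \<omega> * Z q \<omega>) \<in> borel_measurable (M \<tau> \<beta>)"
      unfolding Z_def using Y by (intro borel_measurable_times borel_measurable_diff) auto
    have "\<bar>a * b\<bar> \<le> a\<^sup>2 + b\<^sup>2" for a b :: real
    proof -
      have "2 * (\<bar>a\<bar> * \<bar>b\<bar>) \<le> a\<^sup>2 + b\<^sup>2"
        using sum_squares_bound[of "\<bar>a\<bar>" "\<bar>b\<bar>"] by (simp add: mult.assoc)
      moreover have "0 \<le> \<bar>a\<bar> * \<bar>b\<bar>" by simp
      ultimately show ?thesis unfolding abs_mult by linarith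
    qed
    thus "AE \<omega> in M \<tau> \<beta>. norm (Z p \<omega> * Z q \<omega>) \<le> norm ((Z p \<omega>)\<^sup>2 + (Z q \<omega>)\<^sup>2)" by simp
  qed
  have mean: "expectation (linear_estimator Y c) = (\<Sum>p\<in>UNIV. c p * expectation (Y p))"
    using assms unfolding expectation_linear_estimator[OF assms] block_model_def by simp
  have "(linear_estimator Y c \<omega> - expectation (linear_estimator Y c))\<^sup>2
      = (\<Sum>p\<in>UNIV. \<Sum>q\<in>UNIV. c p * c q * (Z p \<omega> * Z q \<omega>))" for \<omega>
  proof -
    have "linear_estimator Y c \<omega> - expectation (linear_estimator Y c) = (\<Sum>p\<in>UNIV. c p * Z p \<omega>)"
      unfolding mean unfolding linear_estimator_def Z_def
      by (simp add: right_diff_distrib sum_subtractf)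
    thus ?thesis by (simp add: power2_eq_square sum_product mult_ac)
  qed
  hence "variance (linear_estimator Y c)
      = (\<Sum>p\<in>UNIV. \<Sum>q\<in>UNIV. c p * c q * expectation (\<lambda>\<omega>. Z p \<omega> * Z q \<omega>))"
    using ZZ by simp
  also have "\<dots> = (\<Sum>p\<in>UNIV. \<sigma>\<^sup>2 * (c p)\<^sup>2)"
    unfolding cov by (simp add: if_distrib power2_eq_square mult_ac cong: if_cong)
  finally show ?thesis by (simp add: sum_distrib_left)
qed

text \<open>The variance is the error variance times the squared norm of the coefficients, whatever
  the effects. The unbiased coefficient vectors form a closed nonempty set, so its point nearest to
  the origin is a BLUE, and the choice in \<open>BLUE\<close> is meaningful.\<close>

lemma is_BLUE_SOME:
  fixes Y :: "'p::finite \<Rightarrow> 'o \<Rightarrow> real"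
  assumes model: "block_model blk trt \<sigma> M Y" and "estimable M Y f"
  shows "is_BLUE M Y f (SOME c. is_BLUE M Y f c)"
proof -
  define S :: "(real^'p) set" where "S = {x. unbiased M Y f (($) x)}"
  have vec: "($) (\<chi> p. c p) = c" for c :: "'p \<Rightarrow> real" by (simp add: fun_eq_iff)
  obtain c0 where "unbiased M Y f c0" using assms(2) unfolding estimable_def by blast
  hence "(\<chi> p. c0 p) \<in> S" by (simp add: S_def vec)
  hence ne: "S \<noteq> {}" by blast
  have "closed S"
    unfolding S_def unbiased_def expectation_linear_estimator[OF model]
    by (intro closed_Collect_all closed_Collect_eq continuous_intros)
  then obtain x where x: "x \<in> S" "\<And>y. y \<in> S \<Longrightarrow> dist 0 x \<le> dist 0 y"
    using distance_attains_inf[OF _ ne, of 0] by blast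
  have norm_sq: "(norm z)\<^sup>2 = (\<Sum>p\<in>UNIV. (z $ p)\<^sup>2)" for z :: "real^'p"
    unfolding power2_norm_eq_inner by (simp add: inner_vec_def power2_eq_square)
  have "is_BLUE M Y f (($) x)"
    unfolding is_BLUE_def variance_linear_estimator[OF model]
  proof (intro conjI allI impI)
    show "unbiased M Y f (($) x)" using x(1) by (simp add: S_def)
    fix c assume "unbiased M Y f c"
    hence "(\<chi> p. c p) \<in> S" by (simp add: S_def vec)
    from x(2)[OF this] have "(norm x)\<^sup>2 \<le> (norm (\<chi> p. c p))\<^sup>2"
      by (intro power_mono) simp_all
    thus "\<sigma>\<^sup>2 * (\<Sum>p\<in>UNIV. (x $ p)\<^sup>2) \<le> \<sigma>\<^sup>2 * (\<Sum>p\<in>UNIV. (c p)\<^sup>2)"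
      unfolding norm_sq by (intro mult_left_mono) simp_all
  qed
  thus ?thesis by (rule someI[where P = "is_BLUE M Y f"])
qed

section \<open>From the block model to incidence numbers\<close>

theorem mainTheorem2:
  fixes u b k w :: nat
    and blk :: "'p::finite \<Rightarrow> 'j::finite" and trt :: "'p \<Rightarrow> 't::finite" and U :: "'t set"
    and \<sigma> :: real
    and M :: "('t \<Rightarrow> real) \<Rightarrow> ('j \<Rightarrow> real) \<Rightarrow> 'o measure" and Y :: "'p \<Rightarrow> 'o \<Rightarrow> real"
    and \<tau> :: "'t \<Rightarrow> real" and \<beta> :: "'j \<Rightarrow> real"
  assumes "u \<ge> 1" and "b \<ge> 1" and "k \<ge> 1"
    and "b * k = 2 * u + w" and "2 * u > b"
    and "full_design u b k blk trt U"
    and "\<sigma> > 0" and "block_model blk trt \<sigma> M Y"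
    and "connected_design M Y"
  shows "A_value \<sigma> M Y \<tau> \<beta> \<ge> A_bound u b k w"
proof -
  note model = \<open>block_model blk trt \<sigma> M Y\<close>
  define n where "n t j = card {p. trt p = t \<and> blk p = j}" for t j
  define c where "c s t = (SOME c. is_BLUE M Y (contrast s t) c)" for s t
  define v where "v s t = (\<Sum>p\<in>UNIV. (c s t p)\<^sup>2)" for s t
  have design: "CARD('j) = b" "\<And>j. card {p. blk p = j} = k" "card U = u" "card (- U) = w"
    "\<And>i. i \<in> U \<Longrightarrow> card {p. trt p = i} = 2" "\<And>i. i \<notin> U \<Longrightarrow> card {p. trt p = i} = 1"
    using assms unfolding full_design_def by auto
  have unbiased: "(\<Sum>p\<in>UNIV. c s t p * (\<tau> (trt p) + \<beta> (blk p))) = \<tau> s - \<tau> t" for s t \<tau> \<beta>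
  proof -
    have "is_BLUE M Y (contrast s t) (c s t)"
      using is_BLUE_SOME[OF model] assms(9) unfolding c_def connected_design_def by blast
    thus ?thesis
      unfolding is_BLUE_def unbiased_def expectation_linear_estimator[OF model] contrast_def by blast
  qed
  \<comment> \<open>Expand |c - X|^2 >= 0 with X the vector of plot expectations; unbiasedness
    evaluates the inner product of c and X as the contrast.\<close>
  have dual: "v s t \<ge> 2 * (\<tau> s - \<tau> t) - (\<Sum>t\<in>UNIV. \<Sum>j\<in>UNIV. real (n t j) * (\<tau> t + \<beta> j)\<^sup>2)" for s t \<tau> \<beta>
  proof -
    have "0 \<le> (\<Sum>p\<in>UNIV. (c s t p - (\<tau> (trt p) + \<beta> (blk p)))\<^sup>2)"
      by (intro sum_nonneg) simp
    also have "\<dots> = v s t + (\<Sum>p\<in>UNIV. (\<tau> (trt p) + \<beta> (blk p))\<^sup>2)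
        - 2 * (\<Sum>p\<in>UNIV. c s t p * (\<tau> (trt p) + \<beta> (blk p)))"
      unfolding power2_diff sum.distrib sum_subtractf v_def sum_distrib_left mult.assoc ..
    finally show ?thesis
      unfolding unbiased sum_over_plots[of "\<lambda>t j. (\<tau> t + \<beta> j)\<^sup>2" trt blk] n_def by simp
  qed
  interpret incidence_variances n U k v
  proof
    fix j
    have "{p. blk p = j} = (\<Union>t\<in>UNIV. {p. trt p = t \<and> blk p = j})" by auto
    also have "card \<dots> = (\<Sum>t\<in>UNIV. n t j)"
      unfolding n_def by (rule card_UN_disjoint) auto
    finally show "(\<Sum>t\<in>UNIV. n t j) = k" by (simp add: design)
  next
    fix t
    have "{p. trt p = t} = (\<Union>j\<in>UNIV. {p. trt p = t \<and> blk p = j})" by auto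
    also have "card \<dots> = (\<Sum>j\<in>UNIV. n t j)"
      unfolding n_def by (rule card_UN_disjoint) auto
    finally show "(\<Sum>j\<in>UNIV. n t j) = (if t \<in> U then 2 else 1)"
      using design(5,6)[of t] by (cases "t \<in> U") simp_all
  next
    show "k > 0" "U \<noteq> {}" using assms design by auto
  next
    fix \<tau> :: "'t \<Rightarrow> real" and \<beta> :: "'j \<Rightarrow> real" and s t
    assume "\<And>t j. n t j > 0 \<Longrightarrow> \<tau> t + \<beta> j = 0"
    hence "\<tau> (trt p) + \<beta> (blk p) = 0" for p
      unfolding n_def by (auto simp: card_gt_0_iff)
    thus "\<tau> s = \<tau> t" using unbiased[of s t \<tau> \<beta>] by simp
  qed (rule dual)
  have "A_value \<sigma> M Y \<tau> \<beta> = 1 / 2 * (\<Sum>(s, t) | s \<noteq> t. v s t)"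
    using \<open>\<sigma> > 0\<close>
    by (simp add: A_value_def BLUE_def variance_linear_estimator[OF model] v_def c_def
        case_prod_unfold flip: sum_distrib_left)
  also have "(\<Sum>(s, t) | s \<noteq> t. v s t) = (\<Sum>z\<in>UNIV. if fst z = snd z then 0 else v (fst z) (snd z))"
    by (rule sum.mono_neutral_cong_left) auto
  also have "\<dots> = (\<Sum>s\<in>UNIV. \<Sum>t\<in>UNIV. if s = t then 0 else v s t)"
    by (simp add: sum.cartesian_product case_prod_unfold)
  finally show ?thesis using sum_variances assms design by simp
qed

end
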